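(* Let $\mathbb F$ be a field of characteristic different from $2$ and let $\tau=(\tau_{abc})_{a,b,c\in\{0,1\}}$ be an arbitrary $2\times2\times2$ array of elements of $\mathbb F$. Let $\varepsilon_{00}=\varepsilon_{11}=0$, $\varepsilon_{01}=1$, $\varepsilon_{10}=-1$, and define symmetric $2\times 2$ matrices $$(G_1)_{aa'}=\sum_{b,b',c,c'}\varepsilon_{bb'}\varepsilon_{cc'}\tau_{abc}\tau_{a'b'c'},\quad (G_2)_{bb'}=\sum_{a,a',c,c'}\varepsilon_{aa'}\varepsilon_{cc'}\tau_{abc}\tau_{a'b'c'},\quad (G_3)_{cc'}=\sum_{a,a',b,b'}\varepsilon_{aa'}\varepsilon_{bb'}\tau_{abc}\tau_{a'b'c'} .$$ Then $\det(G_1)=\det(G_2)=\det(G_3)$. Equivalently, the three binary quadratic forms $Q_1,Q_2,Q_3$ whose associated symmetric bilinear forms are $G_1,G_2,G_3$ have the same discriminant.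
   Context: The array $\tau_{abc}$ is the coordinate form, in symplectic bases, of a tensor $\tau\in V_1\otimes V_2\otimes V_3$ where $V_1,V_2,V_3$ are two-dimensional $\mathbb F$-vector spaces each with a chosen non-degenerate alternating form (with matrix $\varepsilon$); $G_i$ is regarded as a symmetric bilinear form on $V_i$. A binary quadratic form $Q(x_1,x_2)=ax_1^2+bx_1x_2+cx_2^2$ has associated symmetric bilinear form with matrix $\begin{pmatrix}2a&b\\ b&2c\end{pmatrix}$ and discriminant $b^2-4ac$, which is the negative of the determinant of that matrix. *)

theory Defs
  imports "HOL-Analysis.Analysis"
begin

text \<open>
  The index set \<open>{0, 1}\<close> is the two-element type \<open>2\<close>, whose elements are \<open>0\<close> and \<open>1\<close>
  (in this type the numeral \<open>2\<close> denotes \<open>0\<close>).  An array \<open>t :: 'a^2^2^2\<close> has the entries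
  \<open>t $ a $ b $ c\<close>.
\<close>

definition eps :: "2 \<Rightarrow> 2 \<Rightarrow> 'a::field" where
  "eps i j = (if i = 0 \<and> j = 1 then 1 else if i = 1 \<and> j = 0 then -1 else 0)"

definition G1 :: "'a::field^2^2^2 \<Rightarrow> 'a^2^2" where
  "G1 t = (\<chi> a a'. \<Sum>b\<in>UNIV. \<Sum>b'\<in>UNIV. \<Sum>c\<in>UNIV. \<Sum>c'\<in>UNIV.
     eps b b' * eps c c' * t $ a $ b $ c * t $ a' $ b' $ c')"

definition G2 :: "'a::field^2^2^2 \<Rightarrow> 'a^2^2" where
  "G2 t = (\<chi> b b'. \<Sum>a\<in>UNIV. \<Sum>a'\<in>UNIV. \<Sum>c\<in>UNIV. \<Sum>c'\<in>UNIV.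
     eps a a' * eps c c' * t $ a $ b $ c * t $ a' $ b' $ c')"

definition G3 :: "'a::field^2^2^2 \<Rightarrow> 'a^2^2" where
  "G3 t = (\<chi> c c'. \<Sum>a\<in>UNIV. \<Sum>a'\<in>UNIV. \<Sum>b\<in>UNIV. \<Sum>b'\<in>UNIV.
     eps a a' * eps b b' * t $ a $ b $ c * t $ a' $ b' $ c')"

text \<open>
  \<open>BQF a b c\<close> is the form \<open>a x\<^sub>1\<^sup>2 + b x\<^sub>1 x\<^sub>2 + c x\<^sub>2\<^sup>2\<close>; the variables \<open>x\<^sub>1, x\<^sub>2\<close> are the
  components of a vector at the indices \<open>0, 1\<close>.
\<close>

datatype 'a bqf = BQF (coeff_a: 'a) (coeff_b: 'a) (coeff_c: 'a)

definition bqf_eval :: "'a::field bqf \<Rightarrow> 'a^2 \<Rightarrow> 'a" where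
  "bqf_eval Q x = coeff_a Q * (x $ 0)\<^sup>2 + coeff_b Q * (x $ 0) * (x $ 1) + coeff_c Q * (x $ 1)\<^sup>2"

definition bqf_matrix :: "'a::field bqf \<Rightarrow> 'a^2^2" where
  "bqf_matrix Q = (\<chi> i j. if i = j then (if i = 0 then 2 * coeff_a Q else 2 * coeff_c Q)
                          else coeff_b Q)"

definition bqf_disc :: "'a::field bqf \<Rightarrow> 'a" where
  "bqf_disc Q = (coeff_b Q)\<^sup>2 - 4 * coeff_a Q * coeff_c Q"

lemma UNIV_bit: "(UNIV :: 2 set) = {0, 1}"
  using UNIV_2 by auto

lemma sum_bit: "sum f (UNIV :: 2 set) = f 0 + f 1"
  by (simp add: UNIV_bit)

text \<open>
  The matrix is that of the polar form, without the factor \<open>1/2\<close>.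
\<close>

lemma bqf_matrix_polar:
  "(\<Sum>i\<in>UNIV. \<Sum>j\<in>UNIV. x $ i * bqf_matrix Q $ i $ j * y $ j) =
     bqf_eval Q (x + y) - bqf_eval Q x - bqf_eval Q y"
  by (simp add: sum_bit bqf_matrix_def bqf_eval_def power2_eq_square algebra_simps)

lemma bqf_disc_eq_neg_det: "bqf_disc Q = - det (bqf_matrix Q)"
  by (simp add: det_2 bqf_matrix_def bqf_disc_def power2_eq_square)

lemma transpose_G:
  "transpose (G1 t) = G1 t" "transpose (G2 t) = G2 t" "transpose (G3 t) = G3 t"
  by (simp_all add: transpose_def G1_def G2_def G3_def sum_bit eps_def vec_eq_iff algebra_simps)

end

theory Submission
  imports Defs
begin

text \<open>Contracting \<open>t\<close> with a vector x in one factor leaves a 2x2 matrix, whose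
  determinant is a quadratic form in x; the corresponding \<open>G\<close> is the matrix of its
  polar form. Expanding the three determinants in the eight entries gives one and the same
  polynomial (\<open>det_G\<close>). Discriminants follow by sign, and \<open>bqf_matrix_ex1\<close>
  supplies the quadratic forms.\<close>

text \<open>
  Each determinant is the negative of Cayley's hyperdeterminant of \<open>\<tau>\<close>, in which
  the three tensor factors play symmetric roles.
\<close>

lemma det_G:
  fixes t :: "'a::field^2^2^2"
  shows "det (G1 t) = det (G2 t)" "det (G2 t) = det (G3 t)"
proof -
  define a b c d e f g h where
    "a = t $ 0 $ 0 $ 0" "b = t $ 0 $ 0 $ 1" "c = t $ 0 $ 1 $ 0" "d = t $ 0 $ 1 $ 1"
    "e = t $ 1 $ 0 $ 0" "f = t $ 1 $ 0 $ 1" "g = t $ 1 $ 1 $ 0" "h = t $ 1 $ 1 $ 1"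
  note entries = this[symmetric]
  \<comment> \<open>\<open>det_2\<close> uses the indices 1 and 2; writing 2 as 0 matches the
    indices of \<open>sum_bit\<close>.\<close>
  have det: "det A = A $ 1 $ 1 * A $ 0 $ 0 - A $ 1 $ 0 * A $ 0 $ 1" for A :: "'a^2^2"
  proof -
    have "(2 :: 2) = 0"
      by simp
    then show ?thesis
      by (metis det_2)
  qed
  \<comment> \<open>The diagonal of \<open>G1 t\<close> holds twice the determinants of the two
    slices; the squared term is their polarised determinant.\<close>
  have det_G1: "det (G1 t) = 4 * (a * d - b * c) * (e * h - f * g) - (a * h - b * g - c * f + d * e)\<^sup>2"
    unfolding det
    by (simp add: G1_def sum_bit eps_def entries power2_eq_square algebra_simps)
  have det_G2: "det (G2 t) = 4 * (a * f - b * e) * (c * h - d * g) - (a * h - b * g + c * f - d * e)\<^sup>2"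
    unfolding det
    by (simp add: G2_def sum_bit eps_def entries power2_eq_square algebra_simps)
  have det_G3: "det (G3 t) = 4 * (a * g - c * e) * (b * h - d * f) - (a * h + b * g - c * f - d * e)\<^sup>2"
    unfolding det
    by (simp add: G3_def sum_bit eps_def entries power2_eq_square algebra_simps)
  show "det (G1 t) = det (G2 t)"
    unfolding det_G1 det_G2 by (simp add: power2_eq_square algebra_simps)
  show "det (G2 t) = det (G3 t)"
    unfolding det_G2 det_G3 by (simp add: power2_eq_square algebra_simps)
qed

lemma two_neq_zero_if_CHAR_neq_2:
  assumes "CHAR('a::field) \<noteq> 2"
  shows "(2 :: 'a) \<noteq> 0"
proof
  assume "(2 :: 'a) = 0"
  then have "of_nat 2 = (0 :: 'a)"
    by simp
  then have "CHAR('a) dvd 2"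
    by (simp only: of_nat_eq_0_iff_char_dvd)
  then have "CHAR('a) = 1"
    using assms by (metis two_is_prime_nat prime_nat_iff)
  then show False
    by simp
qed

text \<open>Halving the diagonal recovers the square coefficients, which is possible because 2 is
  invertible. This keeps the claim on discriminants from being vacuous.\<close>

lemma bqf_matrix_ex1:
  fixes A :: "'a::field^2^2"
  assumes "CHAR('a) \<noteq> 2" and sym: "transpose A = A"
  shows "\<exists>!Q. bqf_matrix Q = A"
proof -
  have two: "(2 :: 'a) \<noteq> 0"
    using assms(1) by (rule two_neq_zero_if_CHAR_neq_2)
  have univ: "(\<forall>i :: 2. P i) \<longleftrightarrow> P 0 \<and> P 1" for P
  proof -
    have "(\<forall>i :: 2. P i) \<longleftrightarrow> (\<forall>i \<in> {0, 1}. P i)"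
      by (simp only: UNIV_bit[symmetric] ball_UNIV)
    then show ?thesis
      by simp
  qed
  have "transpose A $ 0 $ 1 = A $ 1 $ 0"
    by (simp add: transpose_def)
  then have sym01: "A $ 1 $ 0 = A $ 0 $ 1"
    unfolding sym by simp
  have half: "2 * x = y \<longleftrightarrow> x = y / 2" for x y :: 'a
    using two by (simp add: eq_divide_eq mult.commute)
  \<comment> \<open>Solving for the coefficients explicitly yields existence and uniqueness at once;
    symmetry makes the two off-diagonal conditions agree.\<close>
  have "bqf_matrix Q = A \<longleftrightarrow> Q = BQF (A $ 0 $ 0 / 2) (A $ 0 $ 1) (A $ 1 $ 1 / 2)" for Q
    by (cases Q) (auto simp: bqf_matrix_def vec_eq_iff univ sym01 half)
  then show ?thesis
    by simp
qed

theorem proposition3: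
  fixes \<tau> :: "'a::field^2^2^2"
  assumes "CHAR('a) \<noteq> 2"
  shows "(det (G1 \<tau>) = det (G2 \<tau>) \<and> det (G2 \<tau>) = det (G3 \<tau>)) \<and>
    (\<exists>!Q. bqf_matrix Q = G1 \<tau>) \<and> (\<exists>!Q. bqf_matrix Q = G2 \<tau>) \<and> (\<exists>!Q. bqf_matrix Q = G3 \<tau>) \<and>
    (\<forall>Q1 Q2 Q3. bqf_matrix Q1 = G1 \<tau> \<and> bqf_matrix Q2 = G2 \<tau> \<and> bqf_matrix Q3 = G3 \<tau> \<longrightarrow>
       bqf_disc Q1 = bqf_disc Q2 \<and> bqf_disc Q2 = bqf_disc Q3)"
  using det_G[of \<tau>] bqf_matrix_ex1[OF assms] transpose_G[of \<tau>]
  by (simp add: bqf_disc_eq_neg_det)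

end
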